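(* Let $S=A+B$ with $A=QQ^*\in\mathbb{C}^{n\times n}$ Hermitian positive definite, $Q\in\mathbb{C}^{n\times n}$, and $B\in\mathbb{C}^{n\times n}$ Hermitian positive semidefinite, let $G=Q^{-1}BQ^{-*}$, let $r<\operatorname{rank}(B)$ be a positive integer, and let $B_r$ and $G_r$ be rank-$r$ truncated SVDs of $B$ and $G$, respectively. Let $\tilde S_r=A+B_r$ and $\widehat S_r=Q(I+G_r)Q^*$. Then $$\mathcal{D}_{\mathrm{LD}}(\tilde S_r,S)\ge\mathcal{D}_{\mathrm{LD}}(\widehat S_r,S).$$
   Context: $M^*$ is the conjugate transpose, $M^{-*}=(M^{-1})^*$. A rank-$r$ truncated SVD of a Hermitian positive semidefinite $M=\sum_{i}\lambda_i(M)v_iv_i^*$ ($v_i$ orthonormal eigenvectors, eigenvalues $\lambda_i(M)$ in nonincreasing order) is $M_r=\sum_{i=1}^r\lambda_i(M)v_iv_i^*$. For Hermitian positive definite $n\times n$ matrices $X,Y$, the Bregman log determinant divergence is $$\mathcal{D}_{\mathrm{LD}}(X,Y)=\operatorname{trace}(XY^{-1})-\log\det(XY^{-1})-n.$$ *)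

theory Defs
  imports
    Complex_Main
    "Jordan_Normal_Form.Matrix"
    "Jordan_Normal_Form.Determinant"
    "Jordan_Normal_Form.Gauss_Jordan_Elimination"
    "Jordan_Normal_Form.Schur_Decomposition"
    "Jordan_Normal_Form.DL_Rank"
begin

definition mat_inv :: "complex mat \<Rightarrow> complex mat" where
  "mat_inv M = the (mat_inverse M)"

definition mat_trace :: "complex mat \<Rightarrow> complex" where
  "mat_trace M = (\<Sum>i<dim_row M. M $$ (i, i))"

(* The inner product (M v) . conj v is the quadratic form v^* M v,
   which is real because M is Hermitian. *)

definition hermitian_psd :: "nat \<Rightarrow> complex mat \<Rightarrow> bool" where
  "hermitian_psd n M \<longleftrightarrow> M \<in> carrier_mat n n \<and> mat_adjoint M = M \<and>
     (\<forall>v \<in> carrier_vec n. Re ((M *\<^sub>v v) \<bullet>c v) \<ge> 0)"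

definition hermitian_pd :: "nat \<Rightarrow> complex mat \<Rightarrow> bool" where
  "hermitian_pd n M \<longleftrightarrow> M \<in> carrier_mat n n \<and> mat_adjoint M = M \<and>
     (\<forall>v \<in> carrier_vec n. v \<noteq> 0\<^sub>v n \<longrightarrow> Re ((M *\<^sub>v v) \<bullet>c v) > 0)"

(* The n x n matrix given by the sum over i < k of lam_i v_i v_i^*, written entrywise. *)

definition spectral_sum :: "nat \<Rightarrow> nat \<Rightarrow> (nat \<Rightarrow> real) \<Rightarrow> (nat \<Rightarrow> complex vec) \<Rightarrow> complex mat" where
  "spectral_sum n k lam v =
     mat n n (\<lambda>(a, b). \<Sum>i<k. complex_of_real (lam i) * (v i $ a * cnj (v i $ b)))"

(* Indices start at 0. The decomposition (full sum for M) together with orthonormality makes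
   each v i an eigenvector of M with eigenvalue lam i. The truncation need not be unique when
   eigenvalues repeat, hence a relation. It is meant for Hermitian positive semidefinite M. *)

definition is_truncated_svd :: "nat \<Rightarrow> nat \<Rightarrow> complex mat \<Rightarrow> complex mat \<Rightarrow> bool" where
  "is_truncated_svd n r M Mr \<longleftrightarrow>
     (\<exists>lam v. (\<forall>i<n. v i \<in> carrier_vec n) \<and>
        (\<forall>i<n. \<forall>j<n. v i \<bullet>c v j = (if i = j then 1 else 0)) \<and>
        (\<forall>i j. i \<le> j \<and> j < n \<longrightarrow> lam j \<le> lam i) \<and>
        M = spectral_sum n n lam v \<and>
        Mr = spectral_sum n r lam v)"

(* For Hermitian positive definite X and Y, trace (X Y^-1) is real and det (X Y^-1) is real and
   positive, so the real parts only change the type. *)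

definition logdet_div :: "complex mat \<Rightarrow> complex mat \<Rightarrow> real" where
  "logdet_div X Y =
     Re (mat_trace (X * mat_inv Y)) - ln (Re (det (X * mat_inv Y))) - real (dim_row X)"

end

theory Submission
  imports Defs
begin

text \<open>
  Diagonalize \<open>G = V diag(g) V\<^sup>*\<close> and put \<open>T = QV\<close>. Then \<open>A = T T\<^sup>*\<close>,
  \<open>S = T diag(1 + g) T\<^sup>*\<close>, and both competitors are congruent by the same \<open>T\<close> to the identity
  plus a positive semidefinite matrix of rank at most \<open>r\<close>: the matrix \<open>Shat\<close> adds the \<open>r\<close>
  largest \<open>g i\<close> on the diagonal, and \<open>Stilde\<close> adds some \<open>K K\<^sup>*\<close> with \<open>K\<close> having \<open>r\<close> columns,
  because \<open>Br\<close> is positive semidefinite with \<open>r\<close> terms. The divergence does not change under a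
  common congruence (\<open>logdet_div_congruence\<close>). So it is enough that among all such \<open>K K\<^sup>*\<close> the
  truncation of \<open>diag(g)\<close> minimizes the divergence from \<open>diag(1 + g)\<close>
  (\<open>truncation_minimizes_logdet_div\<close>).

  For the minimization, rotate \<open>K\<close> by a unitary that diagonalizes \<open>K\<^sup>* K\<close>. This gives \<open>Z\<close> with
  orthogonal columns and \<open>Z Z\<^sup>* = K K\<^sup>*\<close>; let \<open>d j\<close> be its squared column norms. Sylvester's
  identity turns the determinant of \<open>I + Z Z\<^sup>*\<close> into the product of the \<open>1 + d j\<close>. The weights
  \<open>w i j = |Z i j|\<^sup>2 / d j\<close> sum to 1 over \<open>i\<close> (when \<open>d j\<close> is not 0), and by Bessel's inequality to at most 1 over \<open>j\<close>.
  Averaging with them the tangent line estimate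
  \<open>ln (1 + d) \<le> d / (1 + g) + (ln (1 + g) - g / (1 + g))\<close> bounds the log determinant by
  the trace term plus a weighted sum of the gains \<open>\<psi> i = ln (1 + g i) - g i / (1 + g i)\<close>. These
  are nonnegative and increase with \<open>g i\<close>, the total weight of each \<open>\<psi> i\<close> lies between 0 and 1,
  and all weights together make at most \<open>r\<close>, so the weighted sum is at most \<open>\<psi> 0 + ... + \<psi> (r - 1)\<close>
  (\<open>low_rank_logdet_bound\<close>), which is what the truncation of \<open>diag(g)\<close> attains.
\<close>

section \<open>Adjoints, diagonal matrices and inverses\<close>

lemma dim_mat_adjoint [simp]:
  "dim_row (mat_adjoint A) = dim_col A" "dim_col (mat_adjoint A) = dim_row A"
  by (auto simp: mat_adjoint_def)

lemma index_mat_adjoint [simp]: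
  "i < dim_col (A :: complex mat) \<Longrightarrow> j < dim_row A \<Longrightarrow> mat_adjoint A $$ (i, j) = cnj (A $$ (j, i))"
  by (auto simp: mat_adjoint_def mat_of_rows_def)

lemma mat_adjoint_carrier [simp]:
  "A \<in> carrier_mat n m \<Longrightarrow> mat_adjoint A \<in> carrier_mat m n"
  by (rule carrier_matI) (simp_all add: carrier_matD)

lemma mat_adjoint_adjoint [simp]: "mat_adjoint (mat_adjoint A) = (A :: complex mat)"
  by (rule eq_matI) simp_all

lemma mat_adjoint_one [simp]: "mat_adjoint (1\<^sub>m n) = (1\<^sub>m n :: complex mat)"
  by (rule eq_matI) auto

lemma mat_adjoint_mult:
  assumes "A \<in> carrier_mat n m" "B \<in> carrier_mat m k"
  shows "mat_adjoint (A * B) = mat_adjoint B * mat_adjoint (A :: complex mat)"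
  using assms by (intro eq_matI) (auto simp: scalar_prod_def mult.commute)

lemma mat_adjoint_gram:
  assumes "A \<in> carrier_mat n m"
  shows "mat_adjoint (mat_adjoint A * A) = mat_adjoint A * (A :: complex mat)"
  using assms by (simp add: mat_adjoint_mult[of _ m n _ m])

lemma mat_adjoint_diag:
  "mat_adjoint (mat_diag n f) = mat_diag n (\<lambda>i. cnj (f i))"
  by (rule eq_matI) (auto simp: mat_diag_def)

lemma index_mult_mat_sum:
  assumes "A \<in> carrier_mat n m" "B \<in> carrier_mat m k" "i < n" "j < k"
  shows "(A * B) $$ (i, j) = (\<Sum>l<m. A $$ (i, l) * B $$ (l, j))"
  using assms by (auto simp: scalar_prod_def atLeast0LessThan)

lemma index_gram:
  assumes "A \<in> carrier_mat n m" "i < m" "j < m"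
  shows "(mat_adjoint A * A) $$ (i, j) = (\<Sum>k<n. cnj (A $$ (k, i)) * A $$ (k, j))"
  using assms by (subst index_mult_mat_sum[of _ m n _ m]) auto

lemma mult_mat_regroup:
  assumes A: "A \<in> carrier_mat n m" and B: "B \<in> carrier_mat m k"
    and C: "C \<in> carrier_mat k l" and D: "D \<in> carrier_mat l p"
  shows "(A * B) * (C * D) = A * (B * C) * (D :: 'a :: semiring_0 mat)"
proof -
  have "(A * B) * (C * D) = A * B * C * D"
    using A B C D by (intro assoc_mult_mat[symmetric, of _ n k _ l _ p]) auto
  thus ?thesis by (simp add: assoc_mult_mat[OF A B C])
qed

lemma mat_adjoint_inverse:
  assumes "T \<in> carrier_mat n n" "T' \<in> carrier_mat n n" "T * T' = 1\<^sub>m n"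
  shows "mat_adjoint T' * mat_adjoint T = (1\<^sub>m n :: complex mat)"
  using assms mat_adjoint_mult[of T n n T' n] by simp

lemma det_mat_diag: "det (mat_diag n f) = (\<Prod>i<n. f i)"
proof -
  have "det (mat_diag n f) = prod_list (diag_mat (mat_diag n f))"
    by (rule det_upper_triangular[of _ n]) (auto simp: mat_diag_def)
  also have "\<dots> = (\<Prod>i<n. f i)"
    unfolding prod_list_diag_prod by (auto simp: mat_diag_def atLeast0LessThan)
  finally show ?thesis .
qed

lemma mat_inv_eqI:
  assumes M: "M \<in> carrier_mat n n" and N: "N \<in> carrier_mat n n" and MN: "M * N = 1\<^sub>m n"
  shows "mat_inv M = N"
proof -
  have NM: "N * M = 1\<^sub>m n"
    by (rule mat_mult_left_right_inverse[OF M N MN])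
  have "M \<in> Units (ring_mat TYPE(complex) n ())"
    using M N MN NM by (auto simp: Units_def ring_mat_simps)
  then obtain N' where N': "mat_inverse M = Some N'"
    using mat_inverse(1)[OF M, of "()"] by (cases "mat_inverse M") auto
  from mat_inverse(2)[OF M N'] have *: "N' * M = 1\<^sub>m n" "N' \<in> carrier_mat n n" by auto
  have "N' = N' * (M * N)" using MN * by simp
  also have "\<dots> = N' * M * N" by (rule assoc_mult_mat[OF *(2) M N, symmetric])
  also have "\<dots> = N" using N * by simp
  finally show ?thesis using N' by (simp add: mat_inv_def)
qed

lemma mat_inv_right_inverse:
  assumes M: "M \<in> carrier_mat n n" and det: "det M \<noteq> 0"
  shows "mat_inv M \<in> carrier_mat n n" "M * mat_inv M = 1\<^sub>m n"
proof -
  from det_non_zero_imp_unit[OF M det, of "()"]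
  obtain N where "N \<in> carrier_mat n n" "M * N = 1\<^sub>m n"
    by (auto simp: Units_def ring_mat_simps)
  with mat_inv_eqI[OF M this] show "mat_inv M \<in> carrier_mat n n" "M * mat_inv M = 1\<^sub>m n"
    by auto
qed

lemma mat_trace_mult_commute:
  assumes "A \<in> carrier_mat n m" "B \<in> carrier_mat m n"
  shows "mat_trace (A * B) = mat_trace (B * A)"
proof -
  have "mat_trace (A * B) = (\<Sum>i<n. \<Sum>l<m. A $$ (i, l) * B $$ (l, i))"
    using assms by (auto simp: mat_trace_def scalar_prod_def atLeast0LessThan)
  also have "\<dots> = (\<Sum>l<m. \<Sum>i<n. A $$ (i, l) * B $$ (l, i))"
    by (rule sum.swap)
  also have "\<dots> = mat_trace (B * A)"
    using assms by (auto simp: mat_trace_def scalar_prod_def atLeast0LessThan mult.commute)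
  finally show ?thesis .
qed

section \<open>Unitary diagonalization of Hermitian matrices\<close>

text \<open>Complete \<open>v\<close> to a basis, orthogonalize by Gram-Schmidt, which keeps the first vector, and
  normalize the columns.\<close>

lemma unitary_with_first_column:
  assumes v: "v \<in> carrier_vec n" and v0: "v \<noteq> 0\<^sub>v n"
  obtains U c where "U \<in> carrier_mat n n" "mat_adjoint U * U = (1\<^sub>m n :: complex mat)"
    "col U 0 = c \<cdot>\<^sub>v v"
proof -
  interpret cof_vec_space n "TYPE(complex)" .
  define b where "b = basis_completion v"
  define ws where "ws = gram_schmidt n b"
  from v v0 have n: "n > 0" by (cases n) auto
  note bc = basis_completion[OF v v0, folded b_def]
  from gram_schmidt_result[OF bc(2) bc(4) bc(5) ws_def] bc(6)
  have ws: "corthogonal ws" "set ws \<subseteq> carrier_vec n" "length ws = n" by auto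
  from bc(6,7) n obtain vs where bv: "b = v # vs" by (cases b) auto
  have hd: "hd ws = v" unfolding ws_def bv by (rule gram_schmidt_hd[OF v])
  hence ws0: "ws ! 0 = v" using ws n by (cases ws) auto
  have wsc: "ws ! i \<in> carrier_vec n" if "i < n" for i using ws that by auto
  define s where "s i = (\<Sum>k<n. (cmod (ws ! i $ k))\<^sup>2)" for i
  have ip: "ws ! j \<bullet>c ws ! i = (\<Sum>k<n. cnj (ws ! i $ k) * ws ! j $ k)" if "i < n" "j < n" for i j
    using wsc[OF that(1)] wsc[OF that(2)]
    by (auto simp: scalar_prod_def atLeast0LessThan mult.commute)
  have sq: "cnj z * z = complex_of_real ((cmod z)\<^sup>2)" for z :: complex
    by (simp only: complex_norm_square mult.commute)
  have ipii: "ws ! i \<bullet>c ws ! i = complex_of_real (s i)" if "i < n" for i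
    unfolding ip[OF that that] s_def sq by simp
  have spos: "s i > 0" if "i < n" for i
  proof -
    have "complex_of_real (s i) \<noteq> 0"
      using corthogonalD[OF ws(1), of i i] that ws(3) unfolding ipii[OF that, symmetric] by simp
    moreover have "s i \<ge> 0" unfolding s_def by (rule sum_nonneg) simp
    ultimately show ?thesis by simp
  qed
  define U where "U = mat n n (\<lambda>(k, i). ws ! i $ k / complex_of_real (sqrt (s i)))"
  have U: "U \<in> carrier_mat n n" by (simp add: U_def)
  have "mat_adjoint U * U = 1\<^sub>m n"
  proof (rule eq_matI)
    fix i j assume "i < dim_row (1\<^sub>m n :: complex mat)" "j < dim_col (1\<^sub>m n :: complex mat)"
    hence i: "i < n" and j: "j < n" by auto
    have "(mat_adjoint U * U) $$ (i, j) = (\<Sum>k<n. cnj (U $$ (k, i)) * U $$ (k, j))"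
      by (rule index_gram[OF U i j])
    also have "\<dots> = (\<Sum>k<n. cnj (ws ! i $ k) * ws ! j $ k)
        / (complex_of_real (sqrt (s i)) * complex_of_real (sqrt (s j)))"
      unfolding sum_divide_distrib by (rule sum.cong) (auto simp: U_def i j)
    also have "\<dots> = (if i = j then 1 else 0)"
    proof (cases "i = j")
      case True
      have "complex_of_real (sqrt (s j)) * complex_of_real (sqrt (s j)) = complex_of_real (s j)"
        using spos[OF j] by (simp flip: of_real_mult)
      hence "(\<Sum>k<n. cnj (ws ! i $ k) * ws ! j $ k)
          = complex_of_real (sqrt (s i)) * complex_of_real (sqrt (s j))"
        using True ip[OF i j] ipii[OF j] by simp
      thus ?thesis using True spos[OF j] by simp
    next
      case False
      thus ?thesis using corthogonalD[OF ws(1), of j i] i j ws(3) ip[OF i j] by simp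
    qed
    finally show "(mat_adjoint U * U) $$ (i, j) = 1\<^sub>m n $$ (i, j)" using i j by simp
  qed (use U in auto)
  moreover have "col U 0 = (1 / complex_of_real (sqrt (s 0))) \<cdot>\<^sub>v v"
    using n v by (intro eq_vecI) (auto simp: U_def ws0)
  ultimately show ?thesis using that U by blast
qed

text \<open>A unitary whose first column is an eigenvector clears the first column of \<open>M\<close> below the
  diagonal; being Hermitian, the transformed matrix then has a clear first row too.\<close>

lemma hermitian_deflation:
  fixes M :: "complex mat"
  assumes M: "M \<in> carrier_mat (Suc m) (Suc m)" and herm: "mat_adjoint M = M"
  obtains U e N where "U \<in> carrier_mat (Suc m) (Suc m)" "mat_adjoint U * U = 1\<^sub>m (Suc m)"
    "N \<in> carrier_mat m m" "mat_adjoint N = N"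
    "mat_adjoint U * M * U = four_block_mat (mat 1 1 (\<lambda>_. e)) (0\<^sub>m 1 m) (0\<^sub>m m 1) N"
proof -
  let ?n = "Suc m"
  from char_poly_factorized[OF M] obtain as
    where as: "char_poly M = (\<Prod> a \<leftarrow> as. [:- a, 1:])" "length as = ?n" by auto
  then obtain e es where "as = e # es" by (cases as) auto
  hence "eigenvalue M e"
    unfolding eigenvalue_root_char_poly[OF M] as by simp
  then obtain v where "eigenvector M v e" unfolding eigenvalue_def by auto
  hence v: "v \<in> carrier_vec ?n" "v \<noteq> 0\<^sub>v ?n" "M *\<^sub>v v = e \<cdot>\<^sub>v v"
    using M unfolding eigenvector_def by auto
  from unitary_with_first_column[OF v(1,2)] obtain U c
    where U: "U \<in> carrier_mat ?n ?n" and UU: "mat_adjoint U * U = 1\<^sub>m ?n"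
      and U0: "col U 0 = c \<cdot>\<^sub>v v" by blast
  note aU = mat_adjoint_carrier[OF U]
  define M' where "M' = mat_adjoint U * M * U"
  have M': "M' \<in> carrier_mat ?n ?n" using U M aU by (auto simp: M'_def)
  have herm': "mat_adjoint M' = M'"
    unfolding M'_def using U M aU herm
    by (simp add: mat_adjoint_mult[of _ ?n ?n _ ?n] assoc_mult_mat[of _ ?n ?n _ ?n _ ?n])
  have MU0: "M *\<^sub>v col U 0 = e \<cdot>\<^sub>v col U 0"
    unfolding U0 using M v by (simp add: mult_mat_vec smult_smult_assoc mult.commute)
  have col0: "M' $$ (i, 0) = (if i = 0 then e else 0)" if i: "i < ?n" for i
  proof -
    have "M' $$ (i, 0) = (mat_adjoint U * (M * U)) $$ (i, 0)"
      unfolding M'_def by (simp add: assoc_mult_mat[OF aU M U])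
    also have "\<dots> = row (mat_adjoint U) i \<bullet> col (M * U) 0"
      by (rule index_mult_mat(1)) (use U i in simp_all)
    also have "col (M * U) 0 = M *\<^sub>v col U 0"
      by (rule col_mult2[OF M U]) simp
    also have "row (mat_adjoint U) i \<bullet> (M *\<^sub>v col U 0) = e * (row (mat_adjoint U) i \<bullet> col U 0)"
      unfolding MU0 using U aU i by simp
    also have "row (mat_adjoint U) i \<bullet> col U 0 = (mat_adjoint U * U) $$ (i, 0)"
      using U aU i by auto
    finally show ?thesis unfolding UU using i by simp
  qed
  have row0: "M' $$ (0, i) = (if i = 0 then e else 0)" if i: "i < ?n" for i
  proof (cases "i = 0")
    case False
    have "M' $$ (0, i) = mat_adjoint M' $$ (0, i)" using herm' by simp
    also have "\<dots> = cnj (M' $$ (i, 0))" using M' i by (subst index_mat_adjoint) auto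
    finally show ?thesis using col0[OF i] False by simp
  qed (use col0[of 0] in simp)
  define N where "N = mat m m (\<lambda>(i, j). M' $$ (Suc i, Suc j))"
  have N: "N \<in> carrier_mat m m" by (simp add: N_def)
  have "mat_adjoint N = N"
  proof (rule eq_matI)
    fix i j assume "i < dim_row N" "j < dim_col N"
    hence ij: "i < m" "j < m" using N by auto
    have "cnj (M' $$ (Suc j, Suc i)) = mat_adjoint M' $$ (Suc i, Suc j)"
      using M' ij by (subst index_mat_adjoint) auto
    thus "mat_adjoint N $$ (i, j) = N $$ (i, j)"
      using ij N unfolding herm' by (auto simp: N_def)
  qed (use N in auto)
  moreover have "M' = four_block_mat (mat 1 1 (\<lambda>_. e)) (0\<^sub>m 1 m) (0\<^sub>m m 1) N"
    using M' N by (intro eq_matI) (auto simp: N_def col0 row0)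
  ultimately show ?thesis using that[OF U UU N] unfolding M'_def by blast
qed

lemma diagonal_mat_border:
  assumes "N \<in> carrier_mat m m" "diagonal_mat N"
  shows "diagonal_mat (four_block_mat (mat 1 1 (\<lambda>_. e)) (0\<^sub>m 1 m) (0\<^sub>m m 1) N)"
  using assms by (auto simp: diagonal_mat_def)

lemma hermitian_unitary_diagonalization:
  fixes M :: "complex mat"
  assumes "M \<in> carrier_mat n n" "mat_adjoint M = M"
  shows "\<exists>U \<in> carrier_mat n n. mat_adjoint U * U = 1\<^sub>m n \<and> diagonal_mat (mat_adjoint U * M * U)"
  using assms
proof (induction n arbitrary: M)
  case 0
  thus ?case by (intro bexI[of _ "1\<^sub>m 0"]) (auto simp: diagonal_mat_def)
next
  case (Suc m M)
  let ?n = "Suc m"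
  note M = Suc.prems(1)
  obtain U e N where U: "U \<in> carrier_mat ?n ?n" and UU: "mat_adjoint U * U = 1\<^sub>m ?n"
    and N: "N \<in> carrier_mat m m" "mat_adjoint N = N"
    and block: "mat_adjoint U * M * U = four_block_mat (mat 1 1 (\<lambda>_. e)) (0\<^sub>m 1 m) (0\<^sub>m m 1) N"
    using hermitian_deflation[OF Suc.prems] by blast
  from Suc.IH[OF N] obtain V where V: "V \<in> carrier_mat m m"
    and VV: "mat_adjoint V * V = 1\<^sub>m m" and diag: "diagonal_mat (mat_adjoint V * N * V)" by auto
  let ?E = "mat 1 1 (\<lambda>_. e)"
  define F where "F = four_block_mat (1\<^sub>m 1) (0\<^sub>m 1 m) (0\<^sub>m m 1) V"
  have "F \<in> carrier_mat (1 + m) (1 + m)"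
    unfolding F_def using V by (intro four_block_carrier_mat) auto
  hence F: "F \<in> carrier_mat ?n ?n" by simp
  have aF: "mat_adjoint F = four_block_mat (1\<^sub>m 1) (0\<^sub>m 1 m) (0\<^sub>m m 1) (mat_adjoint V)"
    using F V by (intro eq_matI) (auto simp: F_def)
  note aV = mat_adjoint_carrier[OF V]
  note aU = mat_adjoint_carrier[OF U]
  note aF' = mat_adjoint_carrier[OF F]
  have "mat_adjoint F * F = four_block_mat (1\<^sub>m 1) (0\<^sub>m 1 m) (0\<^sub>m m 1) (mat_adjoint V * V)"
    unfolding aF unfolding F_def using V aV
    by (subst mult_four_block_mat[of _ 1 1 _ m _ m]) auto
  hence FF: "mat_adjoint F * F = 1\<^sub>m ?n" unfolding VV by simp
  have VN: "mat_adjoint V * N \<in> carrier_mat m m" "mat_adjoint V * N * V \<in> carrier_mat m m"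
    using V aV N by auto
  have "mat_adjoint F * (mat_adjoint U * M * U) * F
      = four_block_mat ?E (0\<^sub>m 1 m) (0\<^sub>m m 1) (mat_adjoint V * N) * F"
    unfolding aF block by (subst mult_four_block_mat[OF one_carrier_mat zero_carrier_mat zero_carrier_mat aV
        mat_carrier zero_carrier_mat zero_carrier_mat N(1)])
      (use VN aV N in \<open>simp add: right_mult_zero_mat[OF aV]\<close>)
  also have "\<dots> = four_block_mat ?E (0\<^sub>m 1 m) (0\<^sub>m m 1) (mat_adjoint V * N * V)"
    unfolding F_def 
    by (subst mult_four_block_mat[OF mat_carrier zero_carrier_mat zero_carrier_mat VN(1)
        one_carrier_mat zero_carrier_mat zero_carrier_mat V])
      (use VN V N in simp)
  finally have D: "mat_adjoint F * (mat_adjoint U * M * U) * F = \<dots>" .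
  have "mat_adjoint (U * F) * M * (U * F) = mat_adjoint F * (mat_adjoint U * M * U) * F"
  proof -
    have "mat_adjoint (U * F) * M * (U * F) = mat_adjoint F * (mat_adjoint U * M) * (U * F)"
      by (simp only: mat_adjoint_mult[OF U F] assoc_mult_mat[OF aF' aU M])
    thus ?thesis
      by (simp only: mult_mat_regroup[OF aF' mult_carrier_mat[OF aU M] U F])
  qed
  moreover have "diagonal_mat (four_block_mat ?E (0\<^sub>m 1 m) (0\<^sub>m m 1) (mat_adjoint V * N * V))"
    by (rule diagonal_mat_border[OF VN(2) diag])
  ultimately have "diagonal_mat (mat_adjoint (U * F) * M * (U * F))"
    unfolding D by simp
  moreover have "mat_adjoint (U * F) * (U * F) = mat_adjoint F * (mat_adjoint U * U) * F"
    by (simp add: mat_adjoint_mult[OF U F] mult_mat_regroup[OF aF' aU U F])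
  hence "mat_adjoint (U * F) * (U * F) = 1\<^sub>m ?n"
    unfolding UU using FF F aF' by simp
  ultimately show ?case
    by (intro bexI[of _ "U * F"] conjI mult_carrier_mat[OF U F])
qed

section \<open>Matrices with orthogonal columns\<close>

text \<open>Sylvester's identity. Multiplying the block matrix with rows \<open>(I, -A)\<close> and \<open>(B, I)\<close> by the
  unipotent \<open>E\<close> from the right or from the left makes it block triangular, and both products
  have the same determinant.\<close>

lemma det_one_plus_mult_commute:
  fixes A B :: "complex mat"
  assumes A: "A \<in> carrier_mat n m" and B: "B \<in> carrier_mat m n"
  shows "det (1\<^sub>m n + A * B) = det (1\<^sub>m m + B * A)"
proof -
  let ?M = "four_block_mat (1\<^sub>m n) (- A) B (1\<^sub>m m)"
  let ?E = "four_block_mat (1\<^sub>m n) A (0\<^sub>m m n) (1\<^sub>m m)"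
  have M: "?M \<in> carrier_mat (n + m) (n + m)" and E: "?E \<in> carrier_mat (n + m) (n + m)"
    by auto
  have neg: "A + - A = 0\<^sub>m n m" "- A + A = 0\<^sub>m n m" using A by auto
  have "?M * ?E = four_block_mat (1\<^sub>m n) (0\<^sub>m n m) B (1\<^sub>m m + B * A)"
    using A B neg by (subst mult_four_block_mat[of _ n n _ m _ m]) (auto simp: comm_add_mat[of _ m m])
  hence "det (?M * ?E) = det (1\<^sub>m m + B * A)"
    using A B by (simp add: det_four_block_mat_upper_right_zero[of _ n _ m])
  moreover have "?E * ?M = four_block_mat (1\<^sub>m n + A * B) (0\<^sub>m n m) B (1\<^sub>m m)"
    using A B neg by (subst mult_four_block_mat[of _ n n _ m _ m]) auto
  hence "det (?E * ?M) = det (1\<^sub>m n + A * B)"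
    using A B by (simp add: det_four_block_mat_upper_right_zero[of _ n _ m])
  ultimately show ?thesis
    using det_mult[OF M E] det_mult[OF E M] by (simp add: mult.commute)
qed

text \<open>Diagonalizing the small Gram matrix \<open>K\<^sup>* K\<close> rather than \<open>K K\<^sup>*\<close> keeps the number of
  columns at \<open>r\<close>, so the bound \<open>r\<close> on the rank of \<open>K K\<^sup>*\<close> stays visible in the shape of \<open>Z\<close>.\<close>

lemma orthogonal_column_factor:
  fixes K :: "complex mat"
  assumes K: "K \<in> carrier_mat n r"
  obtains Z where "Z \<in> carrier_mat n r" "Z * mat_adjoint Z = K * mat_adjoint K"
    "diagonal_mat (mat_adjoint Z * Z)"
proof -
  note aK = mat_adjoint_carrier[OF K]
  obtain U where U: "U \<in> carrier_mat r r" and UU: "mat_adjoint U * U = 1\<^sub>m r"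
    and diag: "diagonal_mat (mat_adjoint U * (mat_adjoint K * K) * U)"
    using hermitian_unitary_diagonalization[OF mult_carrier_mat[OF aK K] mat_adjoint_gram[OF K]]
    by blast
  note aU = mat_adjoint_carrier[OF U]
  have UU': "U * mat_adjoint U = 1\<^sub>m r" by (rule mat_mult_left_right_inverse[OF aU U UU])
  have "(K * U) * mat_adjoint (K * U) = K * (U * mat_adjoint U) * mat_adjoint K"
    by (simp add: mat_adjoint_mult[OF K U] mult_mat_regroup[OF K U aU aK])
  hence "(K * U) * mat_adjoint (K * U) = K * mat_adjoint K" unfolding UU' using K by simp
  moreover have "mat_adjoint (K * U) * (K * U) = mat_adjoint U * (mat_adjoint K * K) * U"
    by (simp add: mat_adjoint_mult[OF K U] mult_mat_regroup[OF aU aK K U])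
  hence "diagonal_mat (mat_adjoint (K * U) * (K * U))" using diag by simp
  ultimately show ?thesis using that[OF mult_carrier_mat[OF K U]] by blast
qed

definition col_sqnorm :: "complex mat \<Rightarrow> nat \<Rightarrow> real" where
  "col_sqnorm Z j = (\<Sum>i<dim_row Z. (cmod (Z $$ (i, j)))\<^sup>2)"

lemma col_sqnorm_nonneg: "col_sqnorm Z j \<ge> 0"
  unfolding col_sqnorm_def by (rule sum_nonneg) simp

lemma gram_of_orthogonal_columns:
  assumes Z: "Z \<in> carrier_mat n r" and diag: "diagonal_mat (mat_adjoint Z * Z)"
  shows "mat_adjoint Z * Z = mat_diag r (\<lambda>j. complex_of_real (col_sqnorm Z j))"
proof (rule eq_matI)
  fix i j assume "i < dim_row (mat_diag r (\<lambda>j. complex_of_real (col_sqnorm Z j)))"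
    "j < dim_col (mat_diag r (\<lambda>j. complex_of_real (col_sqnorm Z j)))"
  hence ij: "i < r" "j < r" by (auto simp: mat_diag_def)
  show "(mat_adjoint Z * Z) $$ (i, j) = mat_diag r (\<lambda>j. complex_of_real (col_sqnorm Z j)) $$ (i, j)"
  proof (cases "i = j")
    case True
    have "(mat_adjoint Z * Z) $$ (j, j) = (\<Sum>k<n. cnj (Z $$ (k, j)) * Z $$ (k, j))"
      by (rule index_gram[OF Z ij(2) ij(2)])
    also have "\<dots> = complex_of_real (col_sqnorm Z j)"
      unfolding col_sqnorm_def carrier_matD(1)[OF Z] of_real_sum
      by (intro sum.cong refl) (simp only: complex_norm_square mult.commute)
    finally show ?thesis using True ij by (simp add: mat_diag_def)
  next
    case False
    thus ?thesis using diag ij carrier_matD[OF Z] by (simp add: mat_diag_def diagonal_mat_def)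
  qed
qed (use carrier_matD[OF Z] in \<open>simp_all add: mat_diag_def\<close>)

lemma index_self_adjoint_product:
  assumes Z: "Z \<in> carrier_mat n r" and i: "i < n"
  shows "(Z * mat_adjoint Z) $$ (i, i) = complex_of_real (\<Sum>j<r. (cmod (Z $$ (i, j)))\<^sup>2)"
proof -
  have "(Z * mat_adjoint Z) $$ (i, i) = (\<Sum>j<r. Z $$ (i, j) * mat_adjoint Z $$ (j, i))"
    by (rule index_mult_mat_sum[OF Z mat_adjoint_carrier[OF Z] i i])
  also have "\<dots> = (\<Sum>j<r. complex_of_real ((cmod (Z $$ (i, j)))\<^sup>2))"
    by (intro sum.cong refl) (use carrier_matD[OF Z] i in \<open>simp add: complex_norm_square del: of_real_power\<close>)
  finally show ?thesis by simp
qed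

lemma det_one_plus_orthogonal_columns:
  assumes Z: "Z \<in> carrier_mat n r" and diag: "diagonal_mat (mat_adjoint Z * Z)"
  shows "det (1\<^sub>m n + Z * mat_adjoint Z) = complex_of_real (\<Prod>j<r. 1 + col_sqnorm Z j)"
proof -
  have "det (1\<^sub>m n + Z * mat_adjoint Z) = det (1\<^sub>m r + mat_adjoint Z * Z)"
    by (rule det_one_plus_mult_commute[OF Z mat_adjoint_carrier[OF Z]])
  also have "1\<^sub>m r + mat_adjoint Z * Z = mat_diag r (\<lambda>j. complex_of_real (1 + col_sqnorm Z j))"
    unfolding gram_of_orthogonal_columns[OF Z diag] by (rule eq_matI) (auto simp: mat_diag_def)
  finally show ?thesis by (simp add: det_mat_diag)
qed

text \<open>With \<open>D\<close> the diagonal matrix of the reciprocals of the squared column norms,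
  \<open>P = Z D Z\<^sup>*\<close> is the orthogonal projection onto the column space of \<open>Z\<close>, and the sum in question
  is its \<open>i\<close>-th diagonal entry. From \<open>P = P\<^sup>* P\<close> this entry \<open>s\<close> satisfies \<open>s\<^sup>2 \<le> s\<close>.
  Zero columns drop out because division by zero yields zero.\<close>

lemma bessel_orthogonal_columns:
  assumes Z: "Z \<in> carrier_mat n r" and diag: "diagonal_mat (mat_adjoint Z * Z)" and i: "i < n"
  shows "(\<Sum>j<r. (cmod (Z $$ (i, j)))\<^sup>2 / col_sqnorm Z j) \<le> 1"
proof -
  define d where "d = col_sqnorm Z"
  define D where "D = mat_diag r (\<lambda>j. complex_of_real (1 / d j))"
  note aZ = mat_adjoint_carrier[OF Z]
  have D: "D \<in> carrier_mat r r" by (simp add: D_def)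
  define P where "P = Z * D * mat_adjoint Z"
  have ZD: "Z * D \<in> carrier_mat n r" using Z D by simp
  have P: "P \<in> carrier_mat n n" unfolding P_def using ZD aZ by simp
  have DaZ: "D * mat_adjoint Z \<in> carrier_mat r n" using aZ D by simp
  have P': "P = Z * (D * mat_adjoint Z)" unfolding P_def by (rule assoc_mult_mat[OF Z D aZ])
  have aD: "mat_adjoint D = D" by (simp add: D_def mat_adjoint_diag)
  have aP: "mat_adjoint P = P"
    unfolding P_def mat_adjoint_mult[OF ZD aZ] mat_adjoint_mult[OF Z D] aD
    by (simp add: assoc_mult_mat[OF Z D aZ])
  \<comment> \<open>\<open>D\<close> is the pseudoinverse of the Gram matrix, hence \<open>D\<close> times Gram times \<open>D\<close> is \<open>D\<close>, zero columns included.\<close>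
  have DGD: "D * (mat_adjoint Z * Z) * D = D"
    unfolding gram_of_orthogonal_columns[OF Z diag] D_def d_def[symmetric] mat_diag_diag
    by (rule arg_cong[of _ _ "mat_diag r"]) (auto simp: fun_eq_iff)
  have "P * P = (Z * D * mat_adjoint Z) * (Z * (D * mat_adjoint Z))"
    by (simp only: P_def[symmetric] P'[symmetric])
  also have "\<dots> = (Z * D) * (mat_adjoint Z * Z) * (D * mat_adjoint Z)"
    by (rule mult_mat_regroup[OF ZD aZ Z DaZ])
  also have "\<dots> = Z * (D * (mat_adjoint Z * Z)) * (D * mat_adjoint Z)"
    by (simp only: assoc_mult_mat[OF Z D mult_carrier_mat[OF aZ Z]])
  also have "\<dots> = Z * (D * (mat_adjoint Z * Z) * D) * mat_adjoint Z"
    by (rule mult_mat_regroup[OF Z mult_carrier_mat[OF D mult_carrier_mat[OF aZ Z]] D aZ])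
  finally have PP: "P * P = P" unfolding DGD P_def[symmetric] .
  define s where "s = (\<Sum>j<r. (cmod (Z $$ (i, j)))\<^sup>2 / d j)"
  have Pii: "P $$ (i, i) = complex_of_real s"
  proof -
    have "P $$ (i, i) = (\<Sum>j<r. (Z * D) $$ (i, j) * mat_adjoint Z $$ (j, i))"
      unfolding P_def by (rule index_mult_mat_sum[OF ZD aZ i i])
    also have "\<dots> = (\<Sum>j<r. complex_of_real ((cmod (Z $$ (i, j)))\<^sup>2 / d j))"
    proof (intro sum.cong refl)
      fix j assume "j \<in> {..<r}"
      hence j: "j < r" by simp
      have "(Z * D) $$ (i, j) = Z $$ (i, j) * complex_of_real (1 / d j)"
        unfolding D_def mat_diag_mult_right[OF Z] using i j by simp
      thus "(Z * D) $$ (i, j) * mat_adjoint Z $$ (j, i) = complex_of_real ((cmod (Z $$ (i, j)))\<^sup>2 / d j)"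
        using i j carrier_matD[OF Z] by (simp add: complex_norm_square del: of_real_power)
    qed
    finally show ?thesis unfolding s_def by simp
  qed
  have "complex_of_real s = (mat_adjoint P * P) $$ (i, i)" unfolding aP PP Pii ..
  also have "\<dots> = complex_of_real (\<Sum>k<n. (cmod (P $$ (k, i)))\<^sup>2)"
    unfolding index_gram[OF P i i] of_real_sum
    by (intro sum.cong refl) (simp only: complex_norm_square mult.commute)
  finally have "s = (\<Sum>k<n. (cmod (P $$ (k, i)))\<^sup>2)" by (simp only: of_real_eq_iff)
  also have "\<dots> \<ge> (cmod (P $$ (i, i)))\<^sup>2" using i by (intro member_le_sum) auto
  finally have "s * s \<le> s" unfolding Pii by (simp add: power2_eq_square)
  hence "s \<le> 1" by (rule_tac ccontr) (auto simp: mult_le_cancel_right2)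
  thus ?thesis unfolding s_def d_def .
qed

section \<open>The scalar inequality\<close>

text \<open>Subtract the threshold \<open>\<psi> r\<close> from every term: before \<open>r\<close> the differences are nonnegative
  and are largest with weight 1, from \<open>r\<close> on they are nonpositive and are largest with weight 0.
  The subtracted total is at most \<open>\<psi> r\<close> times \<open>r\<close> since the threshold is nonnegative.\<close>

lemma weighted_sum_le_sum_of_largest:
  fixes \<psi> p :: "nat \<Rightarrow> real"
  assumes r: "r < n"
    and mono: "\<And>i j. i \<le> j \<Longrightarrow> j < n \<Longrightarrow> \<psi> j \<le> \<psi> i" and nonneg: "\<psi> r \<ge> 0"
    and p: "\<And>i. i < n \<Longrightarrow> 0 \<le> p i \<and> p i \<le> 1" and psum: "(\<Sum>i<n. p i) \<le> real r"
  shows "(\<Sum>i<n. p i * \<psi> i) \<le> (\<Sum>i<r. \<psi> i)"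
proof -
  define t where "t = \<psi> r"
  have "(\<Sum>i<n. p i * (\<psi> i - t)) \<le> (\<Sum>i<n. if i < r then \<psi> i - t else 0)"
  proof (rule sum_mono)
    fix i assume "i \<in> {..<n}"
    hence i: "i < n" by simp
    show "p i * (\<psi> i - t) \<le> (if i < r then \<psi> i - t else 0)"
    proof (cases "i < r")
      case True
      hence "\<psi> i - t \<ge> 0" using mono[of i r] r by (simp add: t_def)
      thus ?thesis using p[OF i] True by (simp add: mult_left_le_one_le)
    next
      case False
      hence "\<psi> i - t \<le> 0" using mono[of r i] i by (simp add: t_def)
      thus ?thesis using p[OF i] False by (simp add: mult_nonneg_nonpos)
    qed
  qed
  also have "\<dots> = (\<Sum>i<r. \<psi> i - t)"
    using r by (intro sum.mono_neutral_cong_right) auto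
  finally have "(\<Sum>i<n. p i * \<psi> i) - t * (\<Sum>i<n. p i) \<le> (\<Sum>i<r. \<psi> i) - t * real r"
    by (simp add: sum_subtractf right_diff_distrib sum_distrib_left mult.commute)
  moreover have "t * (\<Sum>i<n. p i) \<le> t * real r"
    using nonneg psum by (intro mult_left_mono) (auto simp: t_def)
  ultimately show ?thesis by linarith
qed

text \<open>The right-hand side is the tangent of \<open>d \<mapsto> ln (1 + d)\<close> at \<open>g\<close>, sorted into its slope term
  and a constant that depends on \<open>g\<close> alone.\<close>

lemma ln_one_plus_le_tangent:
  fixes d g :: real
  assumes "d \<ge> 0" "g \<ge> 0"
  shows "ln (1 + d) \<le> d / (1 + g) + (ln (1 + g) - g / (1 + g))"
proof -
  have "ln ((1 + d) / (1 + g)) \<le> (1 + d) / (1 + g) - 1"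
    using assms by (intro ln_le_minus_one) simp
  moreover have "ln ((1 + d) / (1 + g)) = ln (1 + d) - ln (1 + g)"
    using assms by (intro ln_divide_pos) auto
  moreover have "(1 + d) / (1 + g) - 1 = d / (1 + g) - g / (1 + g)"
    using assms by (simp add: divide_simps)
  ultimately show ?thesis by linarith
qed

lemma ln_one_plus_gain_mono:
  fixes g h :: real
  assumes "0 \<le> g" "g \<le> h"
  shows "ln (1 + g) - g / (1 + g) \<le> ln (1 + h) - h / (1 + h)"
proof -
  have "ln (1 + g) \<le> g / (1 + h) + (ln (1 + h) - h / (1 + h))"
    using assms by (intro ln_one_plus_le_tangent) auto
  moreover have "g / (1 + h) \<le> g / (1 + g)"
    using assms by (intro divide_left_mono) auto
  ultimately show ?thesis by linarith
qed

text \<open>The tangent at \<open>g i\<close> is used once for each pair of a column \<open>j\<close> and a row \<open>i\<close>, weighted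
  by the share of row \<open>i\<close> in the squared norm of column \<open>j\<close>. Equality holds when column \<open>j\<close>
  is a multiple of the \<open>j\<close>-th unit vector with squared norm \<open>g j\<close>.\<close>

lemma low_rank_logdet_bound:
  fixes g :: "nat \<Rightarrow> real"
  assumes Z: "Z \<in> carrier_mat n r" and diag: "diagonal_mat (mat_adjoint Z * Z)" and r: "r < n"
    and mono: "\<And>i j. i \<le> j \<Longrightarrow> j < n \<Longrightarrow> g j \<le> g i" and nonneg: "\<And>i. i < n \<Longrightarrow> g i \<ge> 0"
  shows "ln (\<Prod>j<r. 1 + col_sqnorm Z j) - (\<Sum>i<n. (\<Sum>j<r. (cmod (Z $$ (i, j)))\<^sup>2) / (1 + g i))
    \<le> (\<Sum>i<r. ln (1 + g i) - g i / (1 + g i))"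
proof -
  define d where "d = col_sqnorm Z"
  define N where "N i j = (cmod (Z $$ (i, j)))\<^sup>2" for i j
  define \<psi> where "\<psi> i = ln (1 + g i) - g i / (1 + g i)" for i
  define p where "p i = (\<Sum>j<r. N i j / d j)" for i
  have d: "d j = (\<Sum>i<n. N i j)" for j
    by (simp add: d_def N_def col_sqnorm_def carrier_matD(1)[OF Z])
  have d0: "d j \<ge> 0" for j by (simp add: d_def col_sqnorm_nonneg)
  have N0: "N i j \<ge> 0" for i j by (simp add: N_def)
  have \<psi>_mono: "\<psi> j \<le> \<psi> i" if "i \<le> j" "j < n" for i j
    unfolding \<psi>_def using that by (intro ln_one_plus_gain_mono nonneg mono)
  have \<psi>0: "\<psi> i \<ge> 0" if "i < n" for i
    using ln_one_plus_gain_mono[of 0 "g i"] nonneg[OF that] by (simp add: \<psi>_def)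
  \<comment> \<open>A zero column has all its weights equal to 0, but then \<open>ln (1 + d j)\<close> is 0 as well.\<close>
  have weights: "(\<Sum>i<n. N i j / d j) = (if d j = 0 then 0 else 1)" for j
    by (simp flip: sum_divide_distrib d)
  have column: "ln (1 + d j) \<le> (\<Sum>i<n. N i j / (1 + g i)) + (\<Sum>i<n. N i j / d j * \<psi> i)" for j
  proof -
    have "ln (1 + d j) = (\<Sum>i<n. N i j / d j) * ln (1 + d j)"
      unfolding weights by simp
    also have "\<dots> = (\<Sum>i<n. N i j / d j * ln (1 + d j))" by (rule sum_distrib_right)
    also have "\<dots> \<le> (\<Sum>i<n. N i j / d j * (d j / (1 + g i) + \<psi> i))"
      unfolding \<psi>_def using d0[of j] N0 nonneg
      by (intro sum_mono mult_left_mono ln_one_plus_le_tangent) auto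
    also have "\<dots> \<le> (\<Sum>i<n. N i j / (1 + g i) + N i j / d j * \<psi> i)"
    proof (rule sum_mono)
      fix i assume "i \<in> {..<n}"
      hence "N i j / (1 + g i) \<ge> 0" using N0 nonneg by simp
      thus "N i j / d j * (d j / (1 + g i) + \<psi> i) \<le> N i j / (1 + g i) + N i j / d j * \<psi> i"
        by (cases "d j = 0") (auto simp: distrib_left)
    qed
    finally show ?thesis by (simp add: sum.distrib)
  qed
  have p01: "0 \<le> p i \<and> p i \<le> 1" if "i < n" for i
    using bessel_orthogonal_columns[OF Z diag that] N0 d0
    unfolding p_def N_def d_def by (auto intro!: sum_nonneg)
  have "(\<Sum>i<n. p i) = (\<Sum>j<r. \<Sum>i<n. N i j / d j)"
    unfolding p_def by (rule sum.swap)
  also have "\<dots> \<le> (\<Sum>j<r. 1)" unfolding weights by (rule sum_mono) simp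
  finally have psum: "(\<Sum>i<n. p i) \<le> real r" by simp
  have "ln (\<Prod>j<r. 1 + d j) = (\<Sum>j<r. ln (1 + d j))"
  proof (rule ln_prod)
    show "1 + d j \<noteq> 0" for j using d0[of j] by linarith
  qed simp
  also have "\<dots> \<le> (\<Sum>j<r. (\<Sum>i<n. N i j / (1 + g i)) + (\<Sum>i<n. N i j / d j * \<psi> i))"
    by (rule sum_mono) (rule column)
  also have "\<dots> = (\<Sum>i<n. (\<Sum>j<r. N i j) / (1 + g i)) + (\<Sum>i<n. p i * \<psi> i)"
    unfolding sum.distrib p_def sum_divide_distrib sum_distrib_right
    by (intro arg_cong2[of _ _ _ _ "(+)"] sum.swap)
  also have "(\<Sum>i<n. p i * \<psi> i) \<le> (\<Sum>i<r. \<psi> i)"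
    using r \<psi>_mono \<psi>0[OF r] p01 psum by (intro weighted_sum_le_sum_of_largest)
  finally show ?thesis unfolding d_def N_def \<psi>_def by linarith
qed

section \<open>Congruence invariance of the divergence\<close>

text \<open>In \<open>(T X T\<^sup>*) (T D T\<^sup>*)\<^sup>-\<^sup>1 = T (X D\<^sup>-\<^sup>1) T\<^sup>-\<^sup>1\<close> the outer factors form a similarity,
  which changes neither trace nor determinant.\<close>

lemma logdet_div_congruence:
  assumes T: "T \<in> carrier_mat n n" and T': "T' \<in> carrier_mat n n" and TT': "T * T' = 1\<^sub>m n"
    and X: "X \<in> carrier_mat n n" and y: "\<And>i. i < n \<Longrightarrow> y i > (0 :: real)"
  shows "logdet_div (T * X * mat_adjoint T)
      (T * mat_diag n (\<lambda>i. complex_of_real (y i)) * mat_adjoint T)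
    = (\<Sum>i<n. Re (X $$ (i, i)) / y i) - ln (Re (det X) / (\<Prod>i<n. y i)) - real n"
proof -
  define D where "D = mat_diag n (\<lambda>i. complex_of_real (y i))"
  define E where "E = mat_diag n (\<lambda>i. complex_of_real (1 / y i))"
  have D: "D \<in> carrier_mat n n" and E: "E \<in> carrier_mat n n" by (auto simp: D_def E_def)
  have DE: "D * E = 1\<^sub>m n"
    unfolding D_def E_def mat_diag_diag using y
    by (intro eq_matI) (auto simp: mat_diag_def dest!: y)
  have T'T: "T' * T = 1\<^sub>m n" by (rule mat_mult_left_right_inverse[OF T T' TT'])
  note aT = mat_adjoint_carrier[OF T]
  note aT' = mat_adjoint_carrier[OF T']
  note adj = mat_adjoint_inverse[OF T' T T'T]
  define Yi where "Yi = mat_adjoint T' * (E * T')"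
  have ET': "E * T' \<in> carrier_mat n n" using E T' by simp
  have Yi: "Yi \<in> carrier_mat n n" using aT' ET' by (simp add: Yi_def)
  have absorb: "(T * M * mat_adjoint T) * Yi = T * (M * E) * T'" if M: "M \<in> carrier_mat n n" for M
  proof -
    have TM: "T * M \<in> carrier_mat n n" using T M by simp
    have "(T * M * mat_adjoint T) * Yi = T * M * (mat_adjoint T * mat_adjoint T') * (E * T')"
      unfolding Yi_def by (rule mult_mat_regroup[OF TM aT aT' ET'])
    also have "\<dots> = (T * M) * (E * T')" unfolding adj right_mult_one_mat[OF TM] ..
    also have "\<dots> = T * (M * E) * T'" by (rule mult_mat_regroup[OF T M E T'])
    finally show ?thesis .
  qed
  have Y: "T * D * mat_adjoint T \<in> carrier_mat n n"
    by (rule mult_carrier_mat[OF mult_carrier_mat[OF T D] aT])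
  have "mat_inv (T * D * mat_adjoint T) = Yi"
    using absorb[OF D] T TT' unfolding DE by (intro mat_inv_eqI[OF Y Yi]) simp
  hence prod: "(T * X * mat_adjoint T) * mat_inv (T * D * mat_adjoint T) = T * (X * E) * T'"
    using absorb[OF X] by simp
  have XE: "X * E \<in> carrier_mat n n" using X E by simp
  have "mat_trace (T * (X * E) * T') = mat_trace (T' * (T * (X * E)))"
    by (rule mat_trace_mult_commute[OF mult_carrier_mat[OF T XE] T'])
  also have "T' * (T * (X * E)) = X * E"
    by (simp only: assoc_mult_mat[OF T' T XE, symmetric] T'T left_mult_one_mat[OF XE])
  also have "mat_trace (X * E) = (\<Sum>i<n. X $$ (i, i) * complex_of_real (1 / y i))"
    unfolding mat_trace_def E_def mat_diag_mult_right[OF X] by simp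
  finally have trace: "Re (mat_trace (T * (X * E) * T')) = (\<Sum>i<n. Re (X $$ (i, i)) / y i)"
    by (simp del: of_real_divide)
  have "det T * det T' = 1" using det_mult[OF T T'] unfolding TT' by simp
  moreover have "det (T * (X * E) * T') = det T * (det X * det E) * det T'"
    unfolding det_mult[OF mult_carrier_mat[OF T XE] T'] det_mult[OF T XE] det_mult[OF X E] ..
  ultimately have "det (T * (X * E) * T') = det X * det E" by (simp add: algebra_simps)
  also have "det E = complex_of_real (1 / (\<Prod>i<n. y i))"
    unfolding E_def det_mat_diag by (simp add: prod_dividef)
  finally have det: "Re (det (T * (X * E) * T')) = Re (det X) / (\<Prod>i<n. y i)"
    by (simp del: of_real_divide)
  show ?thesis
    unfolding logdet_div_def D_def[symmetric] prod trace det using T by simp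
qed

section \<open>Truncated singular value decompositions\<close>

lemma index_diag_congruence:
  assumes V: "V \<in> carrier_mat n n" and ab: "a < n" "b < n"
  shows "(V * mat_diag n f * mat_adjoint V) $$ (a, b) = (\<Sum>i<n. f i * (V $$ (a, i) * cnj (V $$ (b, i))))"
proof -
  have "V * mat_diag n f \<in> carrier_mat n n" using V by simp
  from index_mult_mat_sum[OF this mat_adjoint_carrier[OF V] ab]
  have "(V * mat_diag n f * mat_adjoint V) $$ (a, b)
      = (\<Sum>i<n. (V * mat_diag n f) $$ (a, i) * mat_adjoint V $$ (i, b))" .
  also have "\<dots> = (\<Sum>i<n. f i * (V $$ (a, i) * cnj (V $$ (b, i))))"
    unfolding mat_diag_mult_right[OF V] using ab carrier_matD[OF V] by (intro sum.cong) auto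
  finally show ?thesis .
qed

lemma truncated_svd_unitary_form:
  assumes svd: "is_truncated_svd n r M Mr" and r: "r \<le> n"
  obtains V lam where "V \<in> carrier_mat n n" "mat_adjoint V * V = 1\<^sub>m n"
    "\<forall>i j. i \<le> j \<and> j < n \<longrightarrow> lam j \<le> lam i"
    "M = V * mat_diag n (\<lambda>i. complex_of_real (lam i)) * mat_adjoint V"
    "Mr = V * mat_diag n (\<lambda>i. complex_of_real (if i < r then lam i else 0)) * mat_adjoint V"
proof -
  obtain lam v where v: "\<forall>i<n. v i \<in> carrier_vec n"
    and orth: "\<forall>i<n. \<forall>j<n. v i \<bullet>c v j = (if i = j then 1 else 0)"
    and mono: "\<forall>i j. i \<le> j \<and> j < n \<longrightarrow> lam j \<le> lam i"
    and M: "M = spectral_sum n n lam v" and Mr: "Mr = spectral_sum n r lam v"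
    using svd unfolding is_truncated_svd_def by (elim exE conjE) (rule that; assumption)
  define V where "V = mat n n (\<lambda>(a, i). v i $ a)"
  have V: "V \<in> carrier_mat n n" by (simp add: V_def)
  have trunc: "spectral_sum n k lam v
      = V * mat_diag n (\<lambda>i. complex_of_real (if i < k then lam i else 0)) * mat_adjoint V"
    if k: "k \<le> n" for k
  proof (rule eq_matI)
    let ?R = "V * mat_diag n (\<lambda>i. complex_of_real (if i < k then lam i else 0)) * mat_adjoint V"
    fix a b assume "a < dim_row ?R" "b < dim_col ?R"
    hence ab: "a < n" "b < n" using carrier_matD[OF V] by auto
    have "?R $$ (a, b) = (\<Sum>i<n. complex_of_real (if i < k then lam i else 0) * (v i $ a * cnj (v i $ b)))"
      unfolding index_diag_congruence[OF V ab] using ab by (intro sum.cong) (auto simp: V_def)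
    also have "\<dots> = (\<Sum>i<k. complex_of_real (lam i) * (v i $ a * cnj (v i $ b)))"
      using k by (intro sum.mono_neutral_cong_right) auto
    finally show "spectral_sum n k lam v $$ (a, b) = ?R $$ (a, b)"
      using ab by (simp add: spectral_sum_def)
  qed (use carrier_matD[OF V] in \<open>simp_all add: spectral_sum_def\<close>)
  have diag_n: "mat_diag n (\<lambda>i. complex_of_real (if i < n then lam i else 0))
      = mat_diag n (\<lambda>i. complex_of_real (lam i))"
    by (rule eq_matI) (auto simp: mat_diag_def)
  have "mat_adjoint V * V = 1\<^sub>m n"
  proof (rule eq_matI)
    fix i j assume "i < dim_row (1\<^sub>m n :: complex mat)" "j < dim_col (1\<^sub>m n :: complex mat)"
    hence ij: "i < n" "j < n" by auto
    have "(mat_adjoint V * V) $$ (i, j) = (\<Sum>k<n. cnj (v i $ k) * v j $ k)"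
      unfolding index_gram[OF V ij] using ij by (intro sum.cong) (auto simp: V_def)
    also have "\<dots> = v j \<bullet>c v i"
      using carrier_vecD[OF v[rule_format, OF ij(1)]] by (simp add: scalar_prod_def atLeast0LessThan mult.commute)
    finally show "(mat_adjoint V * V) $$ (i, j) = 1\<^sub>m n $$ (i, j)"
      using orth ij by simp
  qed (use carrier_matD[OF V] in simp_all)
  thus ?thesis
    by (rule that[OF V]) (use mono trunc[OF r] trunc[of n] in \<open>auto simp: M Mr diag_n\<close>)
qed

text \<open>The \<open>i\<close>-th diagonal entry is the quadratic form of \<open>B\<close> at the \<open>i\<close>-th column of \<open>X\<close>.\<close>

lemma hermitian_psd_diagonal_nonneg:
  assumes B: "hermitian_psd n B" and X: "X \<in> carrier_mat n m" and i: "i < m"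
  shows "Re ((mat_adjoint X * B * X) $$ (i, i)) \<ge> 0"
proof -
  from B have Bc: "B \<in> carrier_mat n n" by (simp add: hermitian_psd_def)
  note aX = mat_adjoint_carrier[OF X]
  have c: "col X i \<in> carrier_vec n" using carrier_matD(1)[OF X] by (metis col_dim)
  have BX: "B * X \<in> carrier_mat n m" using Bc X by simp
  have "(mat_adjoint X * B * X) $$ (i, i) = (mat_adjoint X * (B * X)) $$ (i, i)"
    by (simp only: assoc_mult_mat[OF aX Bc X])
  also have "\<dots> = (\<Sum>k<n. mat_adjoint X $$ (i, k) * (B * X) $$ (k, i))"
    by (rule index_mult_mat_sum[OF aX BX i i])
  also have "\<dots> = (\<Sum>k<n. (B *\<^sub>v col X i) $ k * cnj (col X i $ k))"
    using i carrier_matD[OF X] carrier_matD[OF Bc] by (intro sum.cong) auto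
  also have "\<dots> = (B *\<^sub>v col X i) \<bullet>c col X i"
    using c carrier_matD[OF X] by (simp add: scalar_prod_def atLeast0LessThan)
  finally show ?thesis using B c by (simp add: hermitian_psd_def)
qed

text \<open>This yields the sign of the eigenvalues of \<open>G\<close> (with \<open>P\<close> the inverse of \<open>Q\<close>) and of \<open>B\<close>
  itself (with \<open>P\<close> the identity): \<open>diag(lam)\<close> is \<open>X\<^sup>* B X\<close> for \<open>X = P\<^sup>* V\<close>.\<close>

lemma eigenvalues_of_congruence_nonneg:
  assumes B: "hermitian_psd n B" and P: "P \<in> carrier_mat n n"
    and V: "V \<in> carrier_mat n n" and VV: "mat_adjoint V * V = 1\<^sub>m n"
    and eq: "P * B * mat_adjoint P = V * mat_diag n (\<lambda>i. complex_of_real (lam i)) * mat_adjoint V"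
    and i: "i < n"
  shows "lam i \<ge> 0"
proof -
  let ?D = "mat_diag n (\<lambda>i. complex_of_real (lam i))"
  from B have Bc: "B \<in> carrier_mat n n" by (simp add: hermitian_psd_def)
  note aV = mat_adjoint_carrier[OF V]
  note aP = mat_adjoint_carrier[OF P]
  have D: "?D \<in> carrier_mat n n" by simp
  define X where "X = mat_adjoint P * V"
  have X: "X \<in> carrier_mat n n" unfolding X_def using aP V by simp
  have aX: "mat_adjoint X = mat_adjoint V * P"
    unfolding X_def by (simp add: mat_adjoint_mult[OF aP V])
  have "mat_adjoint X * B * X = mat_adjoint V * (P * B) * (mat_adjoint P * V)"
    unfolding aX unfolding X_def by (simp only: assoc_mult_mat[OF aV P Bc])
  also have "\<dots> = mat_adjoint V * (P * B * mat_adjoint P) * V"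
    by (rule mult_mat_regroup[OF aV mult_carrier_mat[OF P Bc] aP V])
  also have "\<dots> = mat_adjoint V * (V * ?D) * (mat_adjoint V * V)"
    unfolding eq by (rule mult_mat_regroup[OF aV mult_carrier_mat[OF V D] aV V, symmetric])
  also have "\<dots> = mat_adjoint V * (V * ?D)"
    unfolding VV by (rule right_mult_one_mat[OF mult_carrier_mat[OF aV mult_carrier_mat[OF V D]]])
  also have "\<dots> = mat_adjoint V * V * ?D" by (rule assoc_mult_mat[OF aV V D, symmetric])
  also have "\<dots> = ?D" unfolding VV by (rule left_mult_one_mat[OF D])
  finally have XBX: "mat_adjoint X * B * X = ?D" .
  from hermitian_psd_diagonal_nonneg[OF B X i] show ?thesis
    unfolding XBX using i by (simp add: mat_diag_def)
qed

lemma truncation_as_self_adjoint_product: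
  assumes V: "V \<in> carrier_mat n n" and r: "r \<le> n" and nonneg: "\<And>i. i < r \<Longrightarrow> lam i \<ge> 0"
  obtains L where "L \<in> carrier_mat n r"
    "V * mat_diag n (\<lambda>i. complex_of_real (if i < r then lam i else 0)) * mat_adjoint V = L * mat_adjoint L"
proof -
  define L where "L = mat n r (\<lambda>(a, i). complex_of_real (sqrt (lam i)) * V $$ (a, i))"
  have L: "L \<in> carrier_mat n r" by (simp add: L_def)
  let ?R = "V * mat_diag n (\<lambda>i. complex_of_real (if i < r then lam i else 0)) * mat_adjoint V"
  have "?R = L * mat_adjoint L"
  proof (rule eq_matI)
    fix a b assume "a < dim_row (L * mat_adjoint L)" "b < dim_col (L * mat_adjoint L)"
    hence ab: "a < n" "b < n" using carrier_matD[OF L] by auto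
    have sq: "complex_of_real (sqrt (lam i)) * complex_of_real (sqrt (lam i)) = complex_of_real (lam i)"
      if "i < r" for i using nonneg[OF that] by (simp flip: of_real_mult)
    have "?R $$ (a, b) = (\<Sum>i<r. complex_of_real (lam i) * (V $$ (a, i) * cnj (V $$ (b, i))))"
      unfolding index_diag_congruence[OF V ab] using r by (intro sum.mono_neutral_cong_right) auto
    also have "\<dots> = (\<Sum>i<r. L $$ (a, i) * mat_adjoint L $$ (i, b))"
      using ab by (intro sum.cong) (auto simp: L_def sq[symmetric] mult_ac)
    also have "\<dots> = (L * mat_adjoint L) $$ (a, b)"
      by (rule index_mult_mat_sum[OF L mat_adjoint_carrier[OF L] ab, symmetric])
    finally show "?R $$ (a, b) = (L * mat_adjoint L) $$ (a, b)" .
  qed (use carrier_matD[OF V] carrier_matD[OF L] in simp_all)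
  thus ?thesis using that[OF L] by blast
qed

lemma hermitian_pd_det_nonzero:
  assumes "hermitian_pd n A"
  shows "det A \<noteq> 0"
proof
  assume "det A = 0"
  moreover have A: "A \<in> carrier_mat n n" using assms by (simp add: hermitian_pd_def)
  ultimately obtain v where v: "v \<in> carrier_vec n" "v \<noteq> 0\<^sub>v n" "A *\<^sub>v v = 0\<^sub>v n"
    using det_0_iff_vec_prod_zero_field[OF A] by blast
  hence "Re (0\<^sub>v n \<bullet>c v) > 0" using assms unfolding hermitian_pd_def by metis
  thus False using v by simp
qed

section \<open>Optimality of truncating the preconditioned matrix\<close>

text \<open>Both divergences from \<open>S\<close> contain the same sum of the \<open>1 / (1 + g i)\<close> and the same
  log determinant of \<open>diag(1 + g)\<close>. After cancelling them, \<open>low_rank_logdet_bound\<close> remains.\<close>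

lemma truncation_minimizes_logdet_div:
  fixes g :: "nat \<Rightarrow> real"
  assumes T: "T \<in> carrier_mat n n" and T': "T' \<in> carrier_mat n n" and TT': "T * T' = 1\<^sub>m n"
    and r: "r < n"
    and mono: "\<And>i j. i \<le> j \<Longrightarrow> j < n \<Longrightarrow> g j \<le> g i" and nonneg: "\<And>i. i < n \<Longrightarrow> g i \<ge> 0"
    and K: "K \<in> carrier_mat n r"
    and S: "S = T * mat_diag n (\<lambda>i. complex_of_real (1 + g i)) * mat_adjoint T"
  shows "logdet_div (T * mat_diag n (\<lambda>i. complex_of_real (if i < r then 1 + g i else 1)) * mat_adjoint T) S
    \<le> logdet_div (T * (1\<^sub>m n + K * mat_adjoint K) * mat_adjoint T) S"
proof -
  obtain Z where Z: "Z \<in> carrier_mat n r" and ZK: "Z * mat_adjoint Z = K * mat_adjoint K"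
    and diag: "diagonal_mat (mat_adjoint Z * Z)"
    by (rule orthogonal_column_factor[OF K])
  let ?X = "1\<^sub>m n + Z * mat_adjoint Z"
  let ?W = "mat_diag n (\<lambda>i. complex_of_real (if i < r then 1 + g i else 1))"
  define N where "N i = (\<Sum>j<r. (cmod (Z $$ (i, j)))\<^sup>2)" for i
  define Y where "Y = (\<Prod>i<n. 1 + g i)"
  have y: "1 + g i > 0" if "i < n" for i using nonneg[OF that] by simp
  have Y: "Y > 0" unfolding Y_def using y by (intro prod_pos) auto
  have aZ: "mat_adjoint Z \<in> carrier_mat r n" using Z by simp
  have X: "?X \<in> carrier_mat n n" using Z aZ by simp
  have W: "?W \<in> carrier_mat n n" by simp
  have Xii: "Re (?X $$ (i, i)) = 1 + N i" if i: "i < n" for i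
    using i carrier_matD[OF Z] index_self_adjoint_product[OF Z i]
    by (subst index_add_mat) (auto simp: N_def)
  define P where "P = (\<Prod>j<r. 1 + col_sqnorm Z j)"
  have P: "P > 0" unfolding P_def by (intro prod_pos) (simp add: add_pos_nonneg col_sqnorm_nonneg)
  have detX: "Re (det ?X) = P"
    unfolding det_one_plus_orthogonal_columns[OF Z diag] P_def by (rule Re_complex_of_real)
  have "logdet_div (T * ?X * mat_adjoint T) S
      = (\<Sum>i<n. Re (?X $$ (i, i)) / (1 + g i)) - ln (Re (det ?X) / Y) - real n"
    unfolding S Y_def by (rule logdet_div_congruence[OF T T' TT' X y])
  also have "(\<Sum>i<n. Re (?X $$ (i, i)) / (1 + g i)) = (\<Sum>i<n. (1 + N i) / (1 + g i))"
    by (intro sum.cong refl) (simp only: Xii lessThan_iff)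
  finally have 1: "logdet_div (T * ?X * mat_adjoint T) S
      = (\<Sum>i<n. (1 + N i) / (1 + g i)) - ln (P / Y) - real n"
    unfolding detX .
  define R where "R = (\<Prod>i<r. 1 + g i)"
  have R: "R > 0" unfolding R_def using y r by (intro prod_pos) auto
  have "det ?W = complex_of_real (\<Prod>i<n. if i < r then 1 + g i else 1)"
    unfolding det_mat_diag by simp
  also have "(\<Prod>i<n. if i < r then 1 + g i else 1) = R"
    unfolding R_def using r by (intro prod.mono_neutral_cong_right) auto
  finally have detW: "Re (det ?W) = R" by simp
  have "logdet_div (T * ?W * mat_adjoint T) S
      = (\<Sum>i<n. Re (?W $$ (i, i)) / (1 + g i)) - ln (Re (det ?W) / Y) - real n"
    unfolding S Y_def by (rule logdet_div_congruence[OF T T' TT' W y])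
  also have "(\<Sum>i<n. Re (?W $$ (i, i)) / (1 + g i))
      = (\<Sum>i<n. (if i < r then 1 + g i else 1) / (1 + g i))"
    by (intro sum.cong refl) (simp add: mat_diag_def)
  finally have 2: "logdet_div (T * ?W * mat_adjoint T) S
      = (\<Sum>i<n. (if i < r then 1 + g i else 1) / (1 + g i)) - ln (R / Y) - real n"
    unfolding detW .
  have "(\<Sum>i<n. (if i < r then 1 + g i else 1) / (1 + g i))
      = (\<Sum>i<n. 1 / (1 + g i) + (if i < r then g i / (1 + g i) else 0))"
  proof (intro sum.cong refl)
    fix i assume "i \<in> {..<n}"
    thus "(if i < r then 1 + g i else 1) / (1 + g i)
        = 1 / (1 + g i) + (if i < r then g i / (1 + g i) else 0)"
      by (simp flip: add_divide_distrib)
  qed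
  also have "\<dots> = (\<Sum>i<n. 1 / (1 + g i)) + (\<Sum>i<n. if i < r then g i / (1 + g i) else 0)"
    by (rule sum.distrib)
  also have "(\<Sum>i<n. if i < r then g i / (1 + g i) else 0) = (\<Sum>i<r. g i / (1 + g i))"
    using r by (intro sum.mono_neutral_cong_right) auto
  finally have W_trace: "(\<Sum>i<n. (if i < r then 1 + g i else 1) / (1 + g i))
      = (\<Sum>i<n. 1 / (1 + g i)) + (\<Sum>i<r. g i / (1 + g i))" .
  have X_trace: "(\<Sum>i<n. (1 + N i) / (1 + g i)) = (\<Sum>i<n. 1 / (1 + g i)) + (\<Sum>i<n. N i / (1 + g i))"
    by (simp add: add_divide_distrib sum.distrib)
  have "ln R = (\<Sum>i<r. ln (1 + g i))"
    unfolding R_def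
  proof (rule ln_prod)
    show "1 + g i \<noteq> 0" if "i \<in> {..<r}" for i using y[of i] that r by auto
  qed simp
  moreover have "ln P - (\<Sum>i<n. N i / (1 + g i)) \<le> (\<Sum>i<r. ln (1 + g i) - g i / (1 + g i))"
    unfolding P_def N_def by (rule low_rank_logdet_bound[OF Z diag r mono nonneg])
  ultimately have "(\<Sum>i<r. g i / (1 + g i)) - ln R \<le> (\<Sum>i<n. N i / (1 + g i)) - ln P"
    by (simp add: sum_subtractf)
  moreover have "ln (P / Y) = ln P - ln Y" "ln (R / Y) = ln R - ln Y"
    using P R Y by (auto intro: ln_divide_pos)
  ultimately show ?thesis
    unfolding ZK[symmetric] 1 2 W_trace X_trace by linarith
qed

theorem corollary3:
  fixes n r :: nat
    and A B Q S G Br Gr Stilde Shat :: "complex mat"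
  assumes Q: "Q \<in> carrier_mat n n"
    and A: "A = Q * mat_adjoint Q"
    and A_pd: "hermitian_pd n A"
    and B_psd: "hermitian_psd n B"
    and S: "S = A + B"
    and G: "G = mat_inv Q * B * mat_adjoint (mat_inv Q)"
    and r_pos: "0 < r"
    and r_rank: "r < vec_space.rank n B"
    and Br: "is_truncated_svd n r B Br"
    and Gr: "is_truncated_svd n r G Gr"
    and Stilde: "Stilde = A + Br"
    and Shat: "Shat = Q * (1\<^sub>m n + Gr) * mat_adjoint Q"
  shows "logdet_div Stilde S \<ge> logdet_div Shat S"
proof -
  have B: "B \<in> carrier_mat n n" using B_psd by (simp add: hermitian_psd_def)
  have r: "r < n" using r_rank vec_space.rank_le_nc[OF B] by simp
  note aQ = mat_adjoint_carrier[OF Q]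
  have "det Q \<noteq> 0"
    using hermitian_pd_det_nonzero[OF A_pd] det_mult[OF Q aQ] unfolding A by auto
  define P where "P = mat_inv Q"
  note P = mat_inv_right_inverse(1)[OF Q \<open>det Q \<noteq> 0\<close>, folded P_def]
  note QP = mat_inv_right_inverse(2)[OF Q \<open>det Q \<noteq> 0\<close>, folded P_def]
  note aP = mat_adjoint_carrier[OF P]
  have PQ: "P * Q = 1\<^sub>m n" by (rule mat_mult_left_right_inverse[OF Q P QP])
  have aPaQ: "mat_adjoint P * mat_adjoint Q = 1\<^sub>m n" by (rule mat_adjoint_inverse[OF Q P QP])
  obtain V g where V: "V \<in> carrier_mat n n" and VV: "mat_adjoint V * V = 1\<^sub>m n"
    and mono: "\<forall>i j. i \<le> j \<and> j < n \<longrightarrow> g j \<le> g i"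
    and GV: "G = V * mat_diag n (\<lambda>i. complex_of_real (g i)) * mat_adjoint V"
    and GrV: "Gr = V * mat_diag n (\<lambda>i. complex_of_real (if i < r then g i else 0)) * mat_adjoint V"
    by (rule truncated_svd_unitary_form[OF Gr less_imp_le[OF r]])
  note aV = mat_adjoint_carrier[OF V]
  have VV': "V * mat_adjoint V = 1\<^sub>m n" by (rule mat_mult_left_right_inverse[OF aV V VV])
  have "P * B * mat_adjoint P = V * mat_diag n (\<lambda>i. complex_of_real (g i)) * mat_adjoint V"
    unfolding P_def G[symmetric] by (rule GV)
  note g0 = eigenvalues_of_congruence_nonneg[OF B_psd P V VV this]
  have g_mono: "g j \<le> g i" if "i \<le> j" "j < n" for i j using mono that by blast
  \<comment> \<open>\<open>T\<close> is the common congruence: it turns \<open>A\<close> into the identity and \<open>B\<close> into \<open>diag(g)\<close>.\<close>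
  define T where "T = Q * V"
  define T' where "T' = mat_adjoint V * P"
  have T: "T \<in> carrier_mat n n" and T': "T' \<in> carrier_mat n n"
    using Q V aV P by (auto simp: T_def T'_def)
  have TT': "T * T' = 1\<^sub>m n"
    unfolding T_def T'_def mult_mat_regroup[OF Q V aV P] VV' using Q QP by simp
  note aT = mat_adjoint_carrier[OF T]
  have aT_eq: "mat_adjoint T = mat_adjoint V * mat_adjoint Q"
    unfolding T_def by (rule mat_adjoint_mult[OF Q V])

  have conj: "T * M * mat_adjoint T = Q * (V * M * mat_adjoint V) * mat_adjoint Q"
    if M: "M \<in> carrier_mat n n" for M
    unfolding aT_eq unfolding T_def assoc_mult_mat[OF Q V M]
    by (rule mult_mat_regroup[OF Q mult_carrier_mat[OF V M] aV aQ])
  have shift: "Q * (1\<^sub>m n + V * mat_diag n f * mat_adjoint V) * mat_adjoint Q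
      = T * mat_diag n (\<lambda>i. 1 + f i) * mat_adjoint T" for f
  proof -
    have D: "mat_diag n f \<in> carrier_mat n n" by simp
    have "mat_diag n (\<lambda>i. 1 + f i) = 1\<^sub>m n + mat_diag n f"
      by (rule eq_matI) (auto simp: mat_diag_def)
    also have "V * (1\<^sub>m n + mat_diag n f) * mat_adjoint V = (V + V * mat_diag n f) * mat_adjoint V"
      using mult_add_distrib_mat[OF V one_carrier_mat D] V by simp
    also have "\<dots> = 1\<^sub>m n + V * mat_diag n f * mat_adjoint V"
      using add_mult_distrib_mat[OF V mult_carrier_mat[OF V D] aV] VV' by simp
    finally show ?thesis by (simp add: conj)
  qed
  have split: "Q * (1\<^sub>m n + M) * mat_adjoint Q = A + Q * M * mat_adjoint Q"
    if M: "M \<in> carrier_mat n n" for M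
  proof -
    have "Q * (1\<^sub>m n + M) = Q + Q * M"
      using mult_add_distrib_mat[OF Q one_carrier_mat M] Q by simp
    thus ?thesis unfolding A using add_mult_distrib_mat[OF Q mult_carrier_mat[OF Q M] aQ] by simp
  qed

  have Gc: "G \<in> carrier_mat n n" unfolding GV
    by (rule mult_carrier_mat[OF mult_carrier_mat[OF V mat_diag_dim] aV])
  have "Q * G * mat_adjoint Q = Q * (P * B) * (mat_adjoint P * mat_adjoint Q)"
    unfolding G P_def[symmetric] by (rule mult_mat_regroup[OF Q mult_carrier_mat[OF P B] aP aQ, symmetric])
  also have "\<dots> = (Q * P) * B"
    unfolding aPaQ assoc_mult_mat[OF Q P B] using Q P B by simp
  also have "\<dots> = B" unfolding QP using B by simp
  finally have "S = Q * (1\<^sub>m n + G) * mat_adjoint Q" unfolding S split[OF Gc] by simp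
  hence S_T: "S = T * mat_diag n (\<lambda>i. complex_of_real (1 + g i)) * mat_adjoint T"
    unfolding GV shift by simp

  have if_shift: "(\<lambda>i. 1 + complex_of_real (if i < r then g i else 0))
      = (\<lambda>i. complex_of_real (if i < r then 1 + g i else 1))" by auto
  have Shat_T: "Shat = T * mat_diag n (\<lambda>i. complex_of_real (if i < r then 1 + g i else 1)) * mat_adjoint T"
    unfolding Shat GrV shift if_shift ..

  obtain U lam where U: "U \<in> carrier_mat n n" and UU: "mat_adjoint U * U = 1\<^sub>m n"
    and BU: "B = U * mat_diag n (\<lambda>i. complex_of_real (lam i)) * mat_adjoint U"
    and BrU: "Br = U * mat_diag n (\<lambda>i. complex_of_real (if i < r then lam i else 0)) * mat_adjoint U"
    by (rule truncated_svd_unitary_form[OF Br less_imp_le[OF r]])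
  have "1\<^sub>m n * B * mat_adjoint (1\<^sub>m n)
      = U * mat_diag n (\<lambda>i. complex_of_real (lam i)) * mat_adjoint U"
    unfolding BU[symmetric] using B by simp
  from eigenvalues_of_congruence_nonneg[OF B_psd one_carrier_mat U UU this]
  have lam0: "lam i \<ge> 0" if "i < r" for i using that r by simp
  obtain L where L: "L \<in> carrier_mat n r" and BrL: "Br = L * mat_adjoint L"
    unfolding BrU by (rule truncation_as_self_adjoint_product[OF U less_imp_le[OF r] lam0])
  note aL = mat_adjoint_carrier[OF L]

  define K where "K = T' * L"
  have K: "K \<in> carrier_mat n r" using T' L by (simp add: K_def)
  have TK: "T * K = L"
    unfolding K_def using assoc_mult_mat[OF T T' L] TT' L by simp
  have KK: "K * mat_adjoint K \<in> carrier_mat n n" using K by simp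
  have "T * (K * mat_adjoint K) * mat_adjoint T = (T * K) * (mat_adjoint K * mat_adjoint T)"
    by (rule mult_mat_regroup[OF T K mat_adjoint_carrier[OF K] aT, symmetric])
  also have "\<dots> = Br" unfolding mat_adjoint_mult[OF T K, symmetric] TK BrL ..
  finally have TKT: "T * (K * mat_adjoint K) * mat_adjoint T = Br" .
  have TT: "T * mat_adjoint T = A"
    unfolding aT_eq unfolding T_def mult_mat_regroup[OF Q V aV aQ] VV' A using Q by simp
  have "T * (1\<^sub>m n + K * mat_adjoint K) = T + T * (K * mat_adjoint K)"
    using mult_add_distrib_mat[OF T one_carrier_mat KK] T by simp
  hence Stilde_T: "Stilde = T * (1\<^sub>m n + K * mat_adjoint K) * mat_adjoint T"
    unfolding Stilde using add_mult_distrib_mat[OF T mult_carrier_mat[OF T KK] aT] TT TKT by simp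

  show ?thesis
    unfolding Shat_T Stilde_T
    by (rule truncation_minimizes_logdet_div[OF T T' TT' r g_mono g0 K S_T])
qed

end
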